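(* Let $S$ be a finite set with $|S|=n\ge 1$. Let $D_{\mathrm{WO}}^S=(N,A)$ be the network with node set $N=\{X : X\subseteq S\}$, arc set $A=\{(X,Z)\in N\times N : X\subset Z\}$, source $s=\varnothing$ and sink $t=S$. Let $\pi:\mathbb{R}^A\to\mathbb{R}^{S\star S}$ be the linear map sending $\Phi\in\mathbb{R}^A$ to the point $x\in\mathbb{R}^{S\star S}$ given, for all distinct $i,j\in S$, by $$x_{(i,j)}:=\sum\{\Phi_a : a=(X,Z)\in A,\ i\in X \text{ and } j\in Z\setminus X\}.$$ Then $\pi$ maps the flow polytope $F(D_{\mathrm{WO}}^S)$ onto the weak order polytope $P_{\mathrm{WO}}^S$, i.e. $\pi(F(D_{\mathrm{WO}}^S))=P_{\mathrm{WO}}^S$. This yields an extended formulation of $P_{\mathrm{WO}}^S$, namely the canonical description of $F(D_{\mathrm{WO}}^S)$, which has size $3^n-2^n$.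
   Context: Notation: $S\star S:=(S\times S)\setminus\{(i,i): i\in S\}$; $\subset$ denotes strict inclusion. Weak order polytope: a (strict) weak order on $S$ is an asymmetric and negatively transitive relation $R$ on $S$; equivalently, there is a mapping $u:S\to\mathbb{R}$ with $i\,R\,j\iff u(i)<u(j)$ for all $i,j\in S$. For an irreflexive relation $R$ on $S$, its characteristic vector $x^R\in\mathbb{R}^{S\star S}$ has coordinates $(x^R)_{(i,j)}=1$ if $i\,R\,j$ and $0$ otherwise. $P_{\mathrm{WO}}^S$ is the convex hull of the vectors $x^R$, for $R$ ranging over all weak orders on $S$. Flow polytope: let $D=(N,A)$ be an acyclic network (directed graph) with node set $N$, arc set $A$, source $s$ and sink $t$. For a node $v$, $\delta^+(v)$ and $\delta^-(v)$ are the sets of arcs leaving and entering $v$; for $\Phi\in\mathbb{R}^A$ and $B\subseteq A$, $\Phi(B):=\sum_{a\in B}\Phi_a$. The flow polytope $F(D)\subseteq\mathbb{R}^A$ is the polytope whose vertices are the characteristic vectors (in $\{0,1\}^A$) of the arc sets of all directed $s$–$t$ paths in $D$. Its canonical description (a standard fact) is the linear system $$\Phi(\delta^+(v))-\Phi(\delta^-(v))=0\ \ (v\in N\setminus\{s,t\}),\qquad \Phi(\delta^+(s))-\Phi(\delta^-(s))=1,\qquad \Phi_a\ge 0\ \ (a\in A),$$ whose solution set is $F(D)$. Extended formulation: an extended formulation of a polytope $P$ is a linear description (finite system of linear equations and inequalities) of a polytope $Q$ such that some affine map sends $Q$ onto $P$. The size of a linear description is its number of inequalities (equations and variables are not counted);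 so the canonical description of $F(D)$ has size $|A|$. *)

theory Defs
  imports
    "HOL-Analysis.Analysis"
    "HOL-Library.Function_Algebras"
    "Graph_Theory.Graph_Theory"
begin

section \<open>Coordinate spaces over finite index sets\<close>

text \<open>
  For an index set \<open>I :: 'i set\<close>, the space of real vectors with coordinates in \<open>I\<close> is modelled
  as the space of functions \<open>'i \<Rightarrow> real\<close> that vanish outside \<open>I\<close>. This leaves index sets
  as ordinary sets (\<open>I\<close> may be empty), and the pointwise vector space structure makes
  \<^const>\<open>linear\<close>, \<^const>\<open>polytope\<close> and the convex hull of the library available.
\<close>

instantiation "fun" :: (type, real_vector) real_vector
begin

definition scaleR_fun :: "real \<Rightarrow> ('a \<Rightarrow> 'b) \<Rightarrow> 'a \<Rightarrow> 'b" where
  "scaleR_fun r f = (\<lambda>x. r *\<^sub>R f x)"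

instance
  by standard (simp_all add: scaleR_fun_def fun_eq_iff scaleR_add_right scaleR_add_left)

end

lemma scaleR_fun_apply [simp]: "(r *\<^sub>R f) x = r *\<^sub>R f x"
  by (simp add: scaleR_fun_def)

definition coord_space :: "'i set \<Rightarrow> ('i \<Rightarrow> real) set" where
  "coord_space I = {x. \<forall>i. i \<notin> I \<longrightarrow> x i = 0}"


section \<open>Linear descriptions and extended formulations\<close>

text \<open>
  A constraint is a pair \<open>(c, b)\<close> of a coefficient vector and a right-hand side: an equation reads
  \<open>(\<Sum>i. c i * x i) = b\<close>, an inequality reads \<open>(\<Sum>i. c i * x i) \<ge> b\<close>.
\<close>

record 'i lin_system =
  variables :: "'i set"
  equations :: "(('i \<Rightarrow> real) \<times> real) set"
  inequalities :: "(('i \<Rightarrow> real) \<times> real) set"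

definition wf_lin_system :: "'i lin_system \<Rightarrow> bool" where
  "wf_lin_system L \<longleftrightarrow>
     finite (variables L) \<and> finite (equations L) \<and> finite (inequalities L) \<and>
     fst ` (equations L \<union> inequalities L) \<subseteq> coord_space (variables L)"

definition solution_set :: "'i lin_system \<Rightarrow> ('i \<Rightarrow> real) set" where
  "solution_set L =
     {x \<in> coord_space (variables L).
        (\<forall>(c, b) \<in> equations L. (\<Sum>i \<in> variables L. c i * x i) = b) \<and>
        (\<forall>(c, b) \<in> inequalities L. (\<Sum>i \<in> variables L. c i * x i) \<ge> b)}"

definition lin_system_size :: "'i lin_system \<Rightarrow> nat" where
  "lin_system_size L = card (inequalities L)"

definition extended_formulation :: "'i lin_system \<Rightarrow> ('j \<Rightarrow> real) set \<Rightarrow> bool" where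
  "extended_formulation L P \<longleftrightarrow>
     wf_lin_system L \<and> polytope (solution_set L) \<and> polytope P \<and>
     (\<exists>h c. linear h \<and> (\<lambda>x. h x + c) ` solution_set L = P)"


section \<open>The weak order polytope\<close>

definition offdiag :: "'a set \<Rightarrow> ('a \<times> 'a) set" where
  "offdiag S = S \<times> S - Id_on S"

definition weak_order_on :: "'a set \<Rightarrow> 'a rel \<Rightarrow> bool" where
  "weak_order_on S R \<longleftrightarrow>
     R \<subseteq> S \<times> S \<and> asym_on S R \<and>
     (\<forall>i \<in> S. \<forall>j \<in> S. \<forall>k \<in> S. (i, j) \<notin> R \<and> (j, k) \<notin> R \<longrightarrow> (i, k) \<notin> R)"

text \<open>
  A weak order on \<open>S\<close> is irreflexive, hence a subset of \<open>offdiag S\<close>, so that its characteristic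
  vector in the space with coordinates in \<open>offdiag S\<close> is \<open>indicator R\<close>.
\<close>

lemma weak_order_on_indicator:
  assumes "weak_order_on S R"
  shows "(indicator R :: 'a \<times> 'a \<Rightarrow> real) \<in> coord_space (offdiag S)"
  using assms
  by (auto simp: weak_order_on_def coord_space_def offdiag_def asym_on_def indicator_def)

definition weak_order_polytope :: "'a set \<Rightarrow> ('a \<times> 'a \<Rightarrow> real) set" where
  "weak_order_polytope S = convex hull {indicator R | R. weak_order_on S R}"


section \<open>Flow polytopes\<close>

text \<open>
  The flow polytope of the network \<open>D\<close> with source \<open>s\<close> and sink \<open>t\<close>. As the generating points are
  0/1-vectors, they are exactly the vertices of their convex hull. In \<open>apath\<close>, a path is
  represented by its list of arcs.
\<close>

definition flow_polytope :: "('v, 'e) pre_digraph \<Rightarrow> 'v \<Rightarrow> 'v \<Rightarrow> ('e \<Rightarrow> real) set" where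
  "flow_polytope D s t = convex hull {indicator (set p) | p. pre_digraph.apath D s p t}"

text \<open>The coefficient vector of \<open>\<Phi>(\<delta>\<^sup>+(v)) - \<Phi>(\<delta>\<^sup>-(v))\<close>.\<close>

definition net_outflow :: "('v, 'e) pre_digraph \<Rightarrow> 'v \<Rightarrow> 'e \<Rightarrow> real" where
  "net_outflow D v = (\<lambda>a. indicator (out_arcs D v) a - indicator (in_arcs D v) a)"

definition flow_description :: "('v, 'e) pre_digraph \<Rightarrow> 'v \<Rightarrow> 'v \<Rightarrow> 'e lin_system" where
  "flow_description D s t =
     \<lparr>variables = arcs D,
      equations = insert (net_outflow D s, 1) ((\<lambda>v. (net_outflow D v, 0)) ` (verts D - {s, t})),
      inequalities = (\<lambda>a. (indicator {a}, 0)) ` arcs D\<rparr>"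

lemma solution_set_flow_description:
  assumes "finite (arcs D)"
  shows "\<Phi> \<in> solution_set (flow_description D s t) \<longleftrightarrow>
    \<Phi> \<in> coord_space (arcs D) \<and>
    (\<forall>v \<in> verts D - {s, t}. sum \<Phi> (out_arcs D v) - sum \<Phi> (in_arcs D v) = 0) \<and>
    sum \<Phi> (out_arcs D s) - sum \<Phi> (in_arcs D s) = 1 \<and>
    (\<forall>a \<in> arcs D. \<Phi> a \<ge> 0)"
proof -
  have indic: "(\<Sum>a \<in> arcs D. indicator B a * \<Phi> a) = sum \<Phi> B" if "B \<subseteq> arcs D" for B
  proof -
    have "(\<Sum>a \<in> arcs D. indicator B a * \<Phi> a) = sum \<Phi> (arcs D \<inter> B)"
      using assms by (simp add: indicator_def sum.If_cases mult_if_delta)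
    with that show ?thesis by (simp add: Int_absorb1)
  qed
  have net: "(\<Sum>a \<in> arcs D. net_outflow D v a * \<Phi> a)
    = sum \<Phi> (out_arcs D v) - sum \<Phi> (in_arcs D v)" for v
    using indic[of "out_arcs D v"] indic[of "in_arcs D v"]
    by (simp add: net_outflow_def left_diff_distrib sum_subtractf subset_iff)
  have single: "(\<Sum>b \<in> arcs D. indicator {a} b * \<Phi> b) = \<Phi> a" if "a \<in> arcs D" for a
    using indic[of "{a}"] that by simp
  show ?thesis
    unfolding solution_set_def flow_description_def
    using single by (auto simp: net)
qed


section \<open>The network of the weak order polytope\<close>

definition wo_network :: "'a set \<Rightarrow> ('a set, 'a set \<times> 'a set) pre_digraph" where
  "wo_network S =
     \<lparr>verts = Pow S, arcs = {(X, Z). X \<in> Pow S \<and> Z \<in> Pow S \<and> X \<subset> Z}, tail = fst, head = snd\<rparr>"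

lemma digraph_wo_network:
  assumes "finite S"
  shows "digraph (wo_network S)"
proof -
  have "arcs (wo_network S) \<subseteq> Pow S \<times> Pow S"
    by (auto simp: wo_network_def)
  then have "finite (arcs (wo_network S))"
    by (rule finite_subset) (use assms in simp)
  with assms show ?thesis
    by unfold_locales (auto simp: wo_network_def arc_to_ends_def)
qed

lemma acyclic_wo_network: "acyclic (arcs_ends (wo_network S))"
proof -
  have "trans {(X :: 'a set, Z). X \<subset> Z}"
    by (auto intro: transI)
  then have "(arcs_ends (wo_network S))\<^sup>+ \<subseteq> {(X, Z). X \<subset> Z}"
    using trancl_mono_subset[of "arcs_ends (wo_network S)" "{(X, Z). X \<subset> Z}"]
    by (auto simp: wo_network_def arcs_ends_conv)
  then show ?thesis
    by (auto simp: acyclic_def)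
qed

definition wo_projection :: "'a set \<Rightarrow> ('a set \<times> 'a set \<Rightarrow> real) \<Rightarrow> 'a \<times> 'a \<Rightarrow> real" where
  "wo_projection S \<Phi> =
     (\<lambda>(i, j). if (i, j) \<in> offdiag S
        then \<Sum>(X, Z) \<in> {(X, Z) \<in> arcs (wo_network S). i \<in> X \<and> j \<in> Z - X}. \<Phi> (X, Z)
        else 0)"

lemma linear_wo_projection: "linear (wo_projection S)"
  by (rule linearI)
    (auto simp: wo_projection_def fun_eq_iff sum.distrib sum_distrib_left case_prod_beta)

end

theory Submission
  imports Defs
begin

text \<open>
  An \<open>s\<close>-\<open>t\<close> path of the network is a chain from \<open>{}\<close> to \<open>S\<close>, and its arcs \<open>(X, Z)\<close> cut \<open>S\<close> into
  the indifference classes \<open>Z - X\<close> of a weak order. Each \<open>j \<in> S\<close> lies in the class of exactly one arc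
  of the path, so the projection of the path's indicator is the indicator of that weak order, and
  every weak order arises from the chain of its lower sets. By linearity, the projection maps
  convex hull onto convex hull. That the canonical system describes the flow polytope is path
  decomposition: a nonnegative flow of value 1 in a finite acyclic digraph is a convex combination
  of \<open>s\<close>-\<open>t\<close> paths, because a nonnegative circulation there vanishes.
\<close>

section \<open>Flows in finite acyclic digraphs\<close>

definition (in pre_digraph) excess :: "('b \<Rightarrow> real) \<Rightarrow> 'a \<Rightarrow> real" where
  "excess \<Phi> v = sum \<Phi> (out_arcs G v) - sum \<Phi> (in_arcs G v)"

text \<open>\<open>c\<close> is the value of the flow. It is a parameter so that subtracting a
  multiple of a path stays within the notion, and \<open>c = 0\<close> gives circulations. Unlike
  the canonical system, it also fixes the balance at \<open>t\<close>.\<close>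

definition (in pre_digraph) st_flow :: "'a \<Rightarrow> 'a \<Rightarrow> real \<Rightarrow> ('b \<Rightarrow> real) \<Rightarrow> bool" where
  "st_flow s t c \<Phi> \<longleftrightarrow> \<Phi> \<in> coord_space (arcs G) \<and> (\<forall>a. \<Phi> a \<ge> 0) \<and>
     (\<forall>v \<in> verts G. excess \<Phi> v = c * (of_bool (v = s) - of_bool (v = t)))"

locale acyclic_fin_digraph = fin_digraph +
  assumes acyclic_arcs_ends: "acyclic (arcs_ends G)"

section \<open>Linearity of the excess; paths as unit flows\<close>

context fin_digraph
begin

lemma finite_in_out_arcs [simp]: "finite (out_arcs G v)" "finite (in_arcs G v)"
  by (auto simp: out_arcs_def in_arcs_def)

lemma excess_add: "excess (\<Phi> + \<Psi>) v = excess \<Phi> v + excess \<Psi> v"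
  by (simp add: excess_def sum.distrib)

lemma excess_diff: "excess (\<Phi> - \<Psi>) v = excess \<Phi> v - excess \<Psi> v"
  by (simp add: excess_def sum_subtractf)

lemma excess_scaleR: "excess (r *\<^sub>R \<Phi>) v = r * excess \<Phi> v"
  by (simp add: excess_def sum_distrib_left right_diff_distrib)

text \<open>Each arc counts once at its tail and once, negatively, at its head.\<close>

lemma sum_excess: "(\<Sum>v \<in> verts G. excess \<Phi> v) = 0"
proof -
  have "(\<Sum>v \<in> verts G. sum \<Phi> (out_arcs G v)) = sum \<Phi> (arcs G)"
    unfolding out_arcs_def by (rule sum.group) auto
  moreover have "(\<Sum>v \<in> verts G. sum \<Phi> (in_arcs G v)) = sum \<Phi> (arcs G)"
    unfolding in_arcs_def by (rule sum.group) auto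
  ultimately show ?thesis
    by (simp add: excess_def sum_subtractf)
qed

lemma excess_indicator_arc:
  assumes "e \<in> arcs G"
  shows "excess (indicator {e}) v = of_bool (v = tail G e) - of_bool (v = head G e)"
proof -
  have "sum (indicator {e}) B = (of_bool (e \<in> B) :: real)" if "finite B" for B
    using that by (simp add: indicator_def)
  then show ?thesis
    using assms by (auto simp: excess_def)
qed

text \<open>The contributions of the arcs telescope along the path.\<close>

lemma excess_indicator_apath:
  assumes "apath u p v"
  shows "excess (indicator (set p)) w = of_bool (w = u) - of_bool (w = v)"
  using assms
proof (induction p arbitrary: u)
  case Nil
  then show ?case
    by (simp add: apath_Nil_iff excess_def)
next
  case (Cons e p)
  \<comment> \<open>Without repeated arcs, the indicator of the arc set is the sum of the indicators
    of the single arcs.\<close>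
  have "distinct (e # p)"
    using Cons.prems unfolding apath_def by (blast intro: distinct_verts_imp_distinct)
  then have "(indicator (set (e # p)) :: 'b \<Rightarrow> real) = indicator {e} + indicator (set p)"
    by (auto simp: fun_eq_iff indicator_def)
  moreover have "e \<in> arcs G" "tail G e = u" "apath (head G e) p v"
    using Cons.prems by (auto simp: apath_Cons_iff)
  ultimately have "excess (indicator (set (e # p))) w =
      (of_bool (w = u) - of_bool (w = head G e)) + (of_bool (w = head G e) - of_bool (w = v))"
    using Cons.IH by (simp only: excess_add excess_indicator_arc)
  then show ?case
    by simp
qed

lemma st_flow_indicator_apath:
  assumes "apath s p t"
  shows "st_flow s t 1 (indicator (set p))"
proof -
  have "set p \<subseteq> arcs G"
    using assms by (auto simp: apath_def awalk_def)
  then show ?thesis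
    using assms
    by (auto simp: st_flow_def coord_space_def excess_indicator_apath indicator_def)
qed

lemma st_flow_scaleR:
  assumes "st_flow s t c \<Phi>" "r \<ge> 0"
  shows "st_flow s t (r * c) (r *\<^sub>R \<Phi>)"
  using assms by (auto simp: st_flow_def coord_space_def excess_scaleR)

lemma st_flow_diff_apath:
  assumes "st_flow s t c \<Phi>" "apath s p t" "\<And>a. a \<in> set p \<Longrightarrow> r \<le> \<Phi> a"
  shows "st_flow s t (c - r) (\<Phi> - r *\<^sub>R indicator (set p))"
  using assms st_flow_indicator_apath[OF assms(2)]
  by (auto simp: st_flow_def coord_space_def excess_diff excess_scaleR indicator_def
      left_diff_distrib)

lemma convex_st_flow: "convex {\<Phi>. st_flow s t c \<Phi>}"
proof (rule convexI)
  fix \<Phi> \<Psi> and u v :: real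
  assume "\<Phi> \<in> {\<Phi>. st_flow s t c \<Phi>}" "\<Psi> \<in> {\<Phi>. st_flow s t c \<Phi>}" "0 \<le> u" "0 \<le> v" "u + v = 1"
  then show "u *\<^sub>R \<Phi> + v *\<^sub>R \<Psi> \<in> {\<Phi>. st_flow s t c \<Phi>}"
    by (auto simp: st_flow_def coord_space_def excess_add excess_scaleR simp flip: distrib_right)
qed

end

section \<open>Path decomposition in acyclic digraphs\<close>

context acyclic_fin_digraph
begin

text \<open>Returning to a vertex would close a directed cycle. Hence paths can be built as walks,
  without tracking distinctness.\<close>

lemma awalk_imp_apath:
  assumes "awalk u p v"
  shows "apath u p v"
  using assms
proof (induction p arbitrary: u)
  case Nil
  then show ?case
    by (auto simp: awalk_simps apath_simps)
next
  case (Cons e p)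
  then have e: "e \<in> arcs G" "u = tail G e" and p: "awalk (head G e) p v"
    by (auto simp: awalk_Cons_iff)
  have "tail G e \<notin> set (awalk_verts (head G e) p)"
  proof
    assume "tail G e \<in> set (awalk_verts (head G e) p)"
    with p have "(head G e, tail G e) \<in> (arcs_ends G)\<^sup>*"
      by (blast intro: reachable_rtranclI awalk_verts_reachable_from)
    moreover have "(tail G e, head G e) \<in> arcs_ends G"
      using e by (auto simp: arcs_ends_conv)
    ultimately have "(tail G e, tail G e) \<in> (arcs_ends G)\<^sup>+"
      by (rule rtrancl_into_trancl2[rotated])
    then show False
      using acyclic_arcs_ends by (auto simp: acyclic_def)
  qed
  with e p Cons.IH show ?case
    by (auto simp: apath_Cons_iff)
qed

text \<open>The first form gives induction from predecessors to successors, the second from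
  successors to predecessors.\<close>

lemma wf_arcs_ends: "wf (arcs_ends G)" "wf ((arcs_ends G)\<inverse>)"
proof -
  have "finite (arcs_ends G)"
    by (simp add: arcs_ends_def)
  then show "wf (arcs_ends G)" "wf ((arcs_ends G)\<inverse>)"
    using acyclic_arcs_ends by (auto intro: finite_acyclic_wf finite_acyclic_wf_converse)
qed

text \<open>Vanishing spreads along the arcs: if all predecessors of \<open>v\<close> send out
  nothing, the inflow of \<open>v\<close> is 0, so its outflow is 0 by conservation, and
  nonnegativity kills each outgoing arc.\<close>

lemma circulation_eq_0:
  assumes "st_flow s t 0 \<Phi>"
  shows "\<Phi> = 0"
proof -
  have "\<forall>a \<in> out_arcs G v. \<Phi> a = 0" for v
    using wf_arcs_ends(1)
  proof (induction v rule: wf_induct_rule)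
    case (less v)
    show ?case
    proof (cases "v \<in> verts G")
      case True
      have "\<Phi> a = 0" if "a \<in> in_arcs G v" for a
      proof -
        have "(tail G a, v) \<in> arcs_ends G"
          using that by (auto simp: arcs_ends_conv)
        from less[OF this] that show ?thesis
          by auto
      qed
      then have "sum \<Phi> (in_arcs G v) = 0"
        by simp
      moreover have "excess \<Phi> v = 0"
        using assms True by (simp add: st_flow_def)
      ultimately have "sum \<Phi> (out_arcs G v) = 0"
        by (simp add: excess_def)
      then show ?thesis
        using assms by (subst (asm) sum_nonneg_eq_0_iff) (auto simp: st_flow_def)
    qed auto
  qed
  then have "\<Phi> a = 0" for a
    using assms by (cases "a \<in> arcs G") (auto simp: st_flow_def coord_space_def)
  then show ?thesis
    by (simp add: fun_eq_iff)
qed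

text \<open>By conservation, a walk from \<open>s\<close> along positive arcs can be continued at
  every vertex other than \<open>t\<close>; acyclicity and finiteness make it stop.\<close>

lemma positive_apath_exists:
  assumes "st_flow s t c \<Phi>" "c > 0" "s \<noteq> t" "s \<in> verts G"
  obtains p where "apath s p t" "\<And>a. a \<in> set p \<Longrightarrow> \<Phi> a > 0"
proof -
  \<comment> \<open>Positive inflow is what the head of a positive arc inherits, so the claim
    generalised in this way passes through the induction.\<close>
  have "v \<in> verts G \<Longrightarrow> v = s \<or> sum \<Phi> (in_arcs G v) > 0 \<Longrightarrow>
    \<exists>p. awalk v p t \<and> (\<forall>a \<in> set p. \<Phi> a > 0)" for v
    using wf_arcs_ends(2)
  proof (induction v rule: wf_induct_rule)
    case (less v)
    have nonneg: "\<Phi> a \<ge> 0" for a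
      using assms(1) by (simp add: st_flow_def)
    show ?case
    proof (cases "v = t")
      case True
      then show ?thesis
        using less.prems by (intro exI[of _ "[]"]) (simp add: awalk_Nil_iff)
    next
      case False
      then have "sum \<Phi> (out_arcs G v) = sum \<Phi> (in_arcs G v) + c * of_bool (v = s)"
        using assms(1) less.prems(1) by (auto simp: st_flow_def excess_def algebra_simps)
      moreover have "sum \<Phi> (in_arcs G v) \<ge> 0"
        by (simp add: nonneg sum_nonneg)
      ultimately have "sum \<Phi> (out_arcs G v) > 0"
        using less.prems(2) \<open>c > 0\<close> by (auto simp: add_nonneg_pos)
      then obtain a where a: "a \<in> out_arcs G v" "\<Phi> a > 0"
        by (meson not_le sum_nonpos)
      have "sum \<Phi> (in_arcs G (head G a)) > 0"
        using a nonneg by (intro sum_pos2[of _ a]) auto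
      moreover have "(head G a, v) \<in> (arcs_ends G)\<inverse>"
        using a(1) by (auto simp: arcs_ends_conv)
      ultimately obtain p where "awalk (head G a) p t" "\<forall>b \<in> set p. \<Phi> b > 0"
        using less.IH[of "head G a"] a(1) by auto
      then show ?thesis
        using a by (intro exI[of _ "a # p"]) (auto simp: awalk_Cons_iff)
    qed
  qed
  from this[of s] assms(4) that show ?thesis
    using awalk_imp_apath by blast
qed

text \<open>
  Path decomposition, by induction on the size of the support: subtract as much as possible of the
  indicator of a path on which \<open>\<Phi>\<close> is positive, and rescale what remains.
\<close>

lemma st_flow_in_convex_hull:
  assumes "st_flow s t 1 \<Phi>" "s \<noteq> t" "s \<in> verts G"
  shows "\<Phi> \<in> convex hull {indicator (set p) | p. apath s p t}"
  using assms(1)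
proof (induction "card {a. \<Phi> a \<noteq> 0}" arbitrary: \<Phi> rule: less_induct)
  case less
  let ?H = "convex hull {indicator (set p) | p. apath s p t} :: ('b \<Rightarrow> real) set"
  obtain p where p: "apath s p t" and pos: "\<And>a. a \<in> set p \<Longrightarrow> \<Phi> a > 0"
    using positive_apath_exists[OF less.prems] assms by auto
  have ind: "indicator (set p) \<in> ?H"
    using p by (auto intro: hull_inc)
  have "p \<noteq> []"
    using p assms(2) by (auto simp: apath_Nil_iff)
  \<comment> \<open>The bottleneck of \<open>p\<close>: the most that can be subtracted while
    staying nonnegative. An arc \<open>b\<close> attaining it leaves the support.\<close>
  define \<epsilon> where "\<epsilon> = Min (\<Phi> ` set p)"
  have le: "\<epsilon> \<le> \<Phi> a" if "a \<in> set p" for a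
    using that by (simp add: \<epsilon>_def)
  have "\<epsilon> \<in> \<Phi> ` set p"
    unfolding \<epsilon>_def using \<open>p \<noteq> []\<close> by (intro Min_in) auto
  then obtain b where b: "b \<in> set p" "\<Phi> b = \<epsilon>"
    by auto
  then have "\<epsilon> > 0"
    using pos by auto
  show ?case
  proof (cases "\<epsilon> < 1")
    case False
    \<comment> \<open>The whole path fits below the flow, and the remainder is a nonnegative
      circulation.\<close>
    then have "st_flow s t (1 - 1) (\<Phi> - 1 *\<^sub>R indicator (set p))"
      using less.prems p le by (intro st_flow_diff_apath) force+
    then have "\<Phi> = indicator (set p)"
      using circulation_eq_0 by force
    with ind show ?thesis
      by simp
  next
    case True
    \<comment> \<open>The remainder has value \<open>1 - \<epsilon>\<close>; the factor restores
      value 1 for the induction hypothesis.\<close>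
    define \<Psi> where "\<Psi> = (1 / (1 - \<epsilon>)) *\<^sub>R (\<Phi> - \<epsilon> *\<^sub>R indicator (set p))"
    have "st_flow s t (1 / (1 - \<epsilon>) * (1 - \<epsilon>)) \<Psi>"
      unfolding \<Psi>_def
      using less.prems p le True by (intro st_flow_scaleR st_flow_diff_apath) auto
    then have \<Psi>: "st_flow s t 1 \<Psi>"
      using True by simp
    have "{a. \<Phi> a \<noteq> 0} \<subseteq> arcs G"
      using less.prems by (auto simp: st_flow_def coord_space_def)
    then have "finite {a. \<Phi> a \<noteq> 0}"
      by (rule finite_subset) simp
    moreover have "{a. \<Psi> a \<noteq> 0} \<subset> {a. \<Phi> a \<noteq> 0}"
    proof
      show "{a. \<Psi> a \<noteq> 0} \<subseteq> {a. \<Phi> a \<noteq> 0}"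
        using pos by (force simp: \<Psi>_def indicator_def)
      show "{a. \<Psi> a \<noteq> 0} \<noteq> {a. \<Phi> a \<noteq> 0}"
        using b \<open>\<epsilon> > 0\<close> by (auto simp: \<Psi>_def set_eq_iff intro!: exI[of _ b])
    qed
    ultimately have "card {a. \<Psi> a \<noteq> 0} < card {a. \<Phi> a \<noteq> 0}"
      by (rule psubset_card_mono)
    then have "\<Psi> \<in> ?H"
      using \<Psi> by (rule less.hyps)
    moreover have "\<Phi> = \<epsilon> *\<^sub>R indicator (set p) + (1 - \<epsilon>) *\<^sub>R \<Psi>"
      using True by (simp add: \<Psi>_def)
    ultimately show ?thesis
      using ind True \<open>\<epsilon> > 0\<close> by (auto intro!: convexD[OF convex_convex_hull])
  qed
qed

section \<open>The flow polytope and its canonical description\<close>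

lemma flow_polytope_eq_st_flow:
  assumes "s \<noteq> t" "s \<in> verts G"
  shows "flow_polytope G s t = {\<Phi>. st_flow s t 1 \<Phi>}"
proof
  show "flow_polytope G s t \<subseteq> {\<Phi>. st_flow s t 1 \<Phi>}"
    unfolding flow_polytope_def
    by (rule hull_minimal) (auto intro: st_flow_indicator_apath convex_st_flow)
  show "{\<Phi>. st_flow s t 1 \<Phi>} \<subseteq> flow_polytope G s t"
    unfolding flow_polytope_def using assms by (auto intro: st_flow_in_convex_hull)
qed

text \<open>The system has no equation at \<open>t\<close>; that balance is recovered from
  \<open>sum_excess\<close>.\<close>

lemma st_flow_iff_solution:
  assumes "s \<noteq> t" "s \<in> verts G" "t \<in> verts G"
  shows "st_flow s t 1 \<Phi> \<longleftrightarrow> \<Phi> \<in> solution_set (flow_description G s t)"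
proof
  assume "st_flow s t 1 \<Phi>"
  then show "\<Phi> \<in> solution_set (flow_description G s t)"
    using assms unfolding solution_set_flow_description[OF finite_arcs] st_flow_def excess_def
    by auto
next
  assume "\<Phi> \<in> solution_set (flow_description G s t)"
  then have sol: "\<Phi> \<in> coord_space (arcs G)" "\<forall>a \<in> arcs G. \<Phi> a \<ge> 0"
    "\<And>v. v \<in> verts G - {s, t} \<Longrightarrow> excess \<Phi> v = 0" "excess \<Phi> s = 1"
    unfolding solution_set_flow_description[OF finite_arcs] excess_def by auto
  \<comment> \<open>Only \<open>s\<close> and \<open>t\<close> can have nonzero excess, and the
    total is 0.\<close>
  have "(\<Sum>v \<in> verts G. excess \<Phi> v) = (\<Sum>v \<in> {s, t}. excess \<Phi> v)"
    using assms sol(3) by (intro sum.mono_neutral_right) auto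
  then have "excess \<Phi> t = - 1"
    using assms(1) sol(4) sum_excess[of \<Phi>] by simp
  moreover have "\<Phi> a \<ge> 0" for a
    using sol(1,2) by (cases "a \<in> arcs G") (auto simp: coord_space_def)
  ultimately show "st_flow s t 1 \<Phi>"
    using sol assms(1) by (auto simp: st_flow_def)
qed

theorem solution_set_flow_description_eq:
  assumes "s \<noteq> t" "s \<in> verts G" "t \<in> verts G"
  shows "solution_set (flow_description G s t) = flow_polytope G s t"
  using assms by (auto simp: flow_polytope_eq_st_flow st_flow_iff_solution)

lemma polytope_flow_polytope: "polytope (flow_polytope G s t)"
proof -
  have "{indicator (set p) | p. apath s p t} = (\<lambda>p. indicator (set p) :: 'b \<Rightarrow> real) ` {p. apath s p t}"
    by auto
  then show ?thesis
    unfolding flow_polytope_def polytope_def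
    by (metis apaths_finite finite_imageI)
qed

lemma wf_flow_description: "wf_lin_system (flow_description G s t)"
  by (auto simp: wf_lin_system_def flow_description_def coord_space_def net_outflow_def
      indicator_def)

end

text \<open>Inequalities form a set, so distinct arcs must be seen to give distinct
  constraints.\<close>

lemma lin_system_size_flow_description:
  "lin_system_size (flow_description D s t) = card (arcs D)"
proof -
  have "inj_on (\<lambda>a. (indicator {a} :: _ \<Rightarrow> real, 0 :: real)) (arcs D)"
    by (rule inj_onI) (metis indicator_eq_1_iff prod.inject singletonD singletonI)
  then show ?thesis
    by (simp add: lin_system_size_def flow_description_def card_image)
qed


section \<open>Paths in the network and weak orders\<close>

lemma wo_network_simps [simp]:
  "verts (wo_network S) = Pow S"
  "e \<in> arcs (wo_network S) \<longleftrightarrow> fst e \<subset> snd e \<and> snd e \<subseteq> S"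
  "tail (wo_network S) = fst"
  "head (wo_network S) = snd"
  by (auto simp: wo_network_def)

lemma acyclic_fin_digraph_wo_network:
  assumes "finite S"
  shows "acyclic_fin_digraph (wo_network S)"
proof -
  interpret digraph "wo_network S"
    using assms by (rule digraph_wo_network)
  show ?thesis
    by unfold_locales (rule acyclic_wo_network)
qed

section \<open>The number of arcs\<close>

lemma card_arcs_wo_network:
  assumes "finite S"
  shows "card (arcs (wo_network S)) = 3 ^ card S - 2 ^ card S"
proof -
  \<comment> \<open>Grouped by the larger set, the arcs are all pairs of nested subsets minus the
    diagonal.\<close>
  have "arcs (wo_network S) = prod.swap ` ((SIGMA Z : Pow S. Pow Z) - Id_on (Pow S))"
    by (force simp: wo_network_def)
  then have "card (arcs (wo_network S)) = card ((SIGMA Z : Pow S. Pow Z) - Id_on (Pow S))"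
    by (simp only: card_image[OF inj_swap])
  also have "\<dots> = card (SIGMA Z : Pow S. Pow Z) - card (Id_on (Pow S))"
    using assms by (intro card_Diff_subset) (auto simp: Id_on_def)
  also have "card (Id_on (Pow S)) = 2 ^ card S"
  proof -
    have "Id_on (Pow S) = (\<lambda>X. (X, X)) ` Pow S"
      by auto
    then show ?thesis
      using assms by (simp add: card_image inj_on_def card_Pow)
  qed
  also have "card (SIGMA Z : Pow S. Pow Z) = (\<Sum>Z \<in> Pow S. 2 ^ card Z)"
    using assms by (subst card_SigmaI) (auto intro!: sum.cong simp: card_Pow finite_subset)
  \<comment> \<open>Expanding the product over \<open>S\<close> yields one term
    \<open>2 ^ card Z\<close> for each subset \<open>Z\<close>.\<close>
  also have "\<dots> = (\<Prod>x \<in> S. 2 + 1)"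
    using assms by (subst prod_add) simp_all
  finally show ?thesis
    by simp
qed

text \<open>The condition on \<open>(X, Z)\<close> is the one under the sum in
  \<open>wo_projection\<close>: \<open>i\<close> is already present when \<open>j\<close>
  enters.\<close>

definition path_rel :: "('a set \<times> 'a set) list \<Rightarrow> 'a rel" where
  "path_rel p = {(i, j). \<exists>(X, Z) \<in> set p. i \<in> X \<and> j \<in> Z - X}"

section \<open>Chains of subsets, their weak orders and the projection\<close>

context
  fixes S :: "'a set"
  assumes fin: "finite S"
begin

interpretation acyclic_fin_digraph "wo_network S"
  using fin by (rule acyclic_fin_digraph_wo_network)

lemma awalk_wo_Cons_iff:
  "awalk X (e # p) Y \<longleftrightarrow> fst e = X \<and> X \<subset> snd e \<and> snd e \<subseteq> S \<and> awalk (snd e) p Y"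
  by (auto simp: awalk_Cons_iff)

lemma awalk_wo_subset:
  assumes "awalk X p Y"
  shows "X \<subseteq> Y"
  using assms
proof (induction p arbitrary: X)
  case (Cons e p)
  then show ?case
    unfolding awalk_wo_Cons_iff by blast
qed (simp add: awalk_Nil_iff)

lemma awalk_wo_arc_subset:
  assumes "awalk X p Y" "(U, V) \<in> set p"
  shows "X \<subseteq> U \<and> U \<subset> V \<and> V \<subseteq> Y"
  using assms
proof (induction p arbitrary: X)
  case (Cons e p)
  then have e: "fst e = X" "X \<subset> snd e" and p: "awalk (snd e) p Y"
    by (simp_all add: awalk_wo_Cons_iff)
  show ?case
  proof (cases "e = (U, V)")
    case True
    with e awalk_wo_subset[OF p] show ?thesis
      by simp
  next
    case False
    with e Cons.IH[OF p] Cons.prems(2) show ?thesis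
      by auto
  qed
qed simp

text \<open>The nodes of a walk form an increasing chain, so of two different arcs one ends before
  the other starts.\<close>

lemma awalk_wo_arcs_linear:
  assumes "awalk X p Y" "(U, V) \<in> set p" "(U', V') \<in> set p"
  shows "(U, V) = (U', V') \<or> V \<subseteq> U' \<or> V' \<subseteq> U"
  using assms
proof (induction p arbitrary: X)
  case (Cons e p)
  then have p: "awalk (snd e) p Y"
    by (simp add: awalk_wo_Cons_iff)
  have "snd e \<subseteq> U''" if "(U'', V'') \<in> set p" for U'' V''
    using awalk_wo_arc_subset[OF p that] by simp
  with Cons.prems(2,3) Cons.IH[OF p] show ?case
    by (metis set_ConsD snd_conv)
qed simp

text \<open>Some step of the chain must bring in \<open>j\<close>. By
  \<open>awalk_wo_arcs_linear\<close> no second step does.\<close>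

lemma awalk_wo_entering_arc:
  assumes "awalk X p Y" "j \<in> Y - X"
  shows "\<exists>U V. (U, V) \<in> set p \<and> j \<in> V - U"
  using assms
proof (induction p arbitrary: X)
  case (Cons e p)
  then have "fst e = X" "awalk (snd e) p Y"
    by (simp_all add: awalk_wo_Cons_iff)
  then show ?case
    using Cons.IH[of "snd e"] Cons.prems(2) by (cases e; cases "j \<in> snd e") auto
qed (auto simp: awalk_Nil_iff)

lemma weak_order_path_rel:
  assumes "awalk {} p S"
  shows "weak_order_on S (path_rel p)"
  unfolding weak_order_on_def
proof (intro conjI ballI impI)
  show "path_rel p \<subseteq> S \<times> S"
    using awalk_wo_arc_subset[OF assms] by (fastforce simp: path_rel_def)
  show "asym_on S (path_rel p)"
  proof (rule asym_onI, rule notI)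
    fix i j
    assume "(i, j) \<in> path_rel p" "(j, i) \<in> path_rel p"
    then obtain U V U' V' where UV: "(U, V) \<in> set p" "i \<in> U" "j \<in> V - U"
      and UV': "(U', V') \<in> set p" "j \<in> U'" "i \<in> V' - U'"
      by (auto simp: path_rel_def)
    then show False
      using awalk_wo_arcs_linear[OF assms UV(1) UV'(1)] awalk_wo_arc_subset[OF assms UV(1)]
        awalk_wo_arc_subset[OF assms UV'(1)] by auto
  qed
  fix i j k
  assume "j \<in> S" and not: "(i, j) \<notin> path_rel p \<and> (j, k) \<notin> path_rel p"
  obtain U V where UV: "(U, V) \<in> set p" "j \<in> V - U"
    using awalk_wo_entering_arc[OF assms, of j] \<open>j \<in> S\<close> by blast
  show "(i, k) \<notin> path_rel p"
  proof
    assume "(i, k) \<in> path_rel p"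
    then obtain X Z where XZ: "(X, Z) \<in> set p" "i \<in> X" "k \<in> Z - X"
      by (auto simp: path_rel_def)
    \<comment> \<open>Each comparison of the arcs fails: equal arcs or
      \<open>Z \<subseteq> U\<close> would put \<open>i\<close> into \<open>U\<close>, and
      \<open>V \<subseteq> X\<close> would put \<open>j\<close> into \<open>X\<close>.\<close>
    then have "j \<notin> X" "i \<notin> U"
      using not UV by (auto simp: path_rel_def)
    then show False
      using awalk_wo_arcs_linear[OF assms UV(1) XZ(1)] awalk_wo_arc_subset[OF assms XZ(1)] UV XZ
      by auto
  qed
qed

text \<open>
  The nodes of the walk are the lower sets of the weak order; the last arc adds the maximal
  elements.
\<close>

lemma weak_order_obtains_awalk:
  assumes "weak_order_on Z R" "Z \<subseteq> S"
  obtains p where "awalk {} p Z" "path_rel p = R"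
proof -
  have "finite Z"
    using assms(2) fin by (rule finite_subset)
  \<comment> \<open>General subsets \<open>Z\<close> are needed because the induction removes the
    top indifference class.\<close>
  then have "\<exists>p. awalk {} p Z \<and> path_rel p = R"
    using assms
  proof (induction Z arbitrary: R rule: finite_psubset_induct)
    case (psubset Z)
    have R: "R \<subseteq> Z \<times> Z"
      using psubset.prems(1) by (simp add: weak_order_on_def)
    have asym: "\<And>i j. (i, j) \<in> R \<Longrightarrow> (j, i) \<notin> R"
      using psubset.prems(1) R unfolding weak_order_on_def asym_on_def by blast
    have negtrans: "\<And>i j k. \<lbrakk>i \<in> Z; j \<in> Z; k \<in> Z; (i, j) \<notin> R; (j, k) \<notin> R\<rbrakk> \<Longrightarrow> (i, k) \<notin> R"
      using psubset.prems(1) unfolding weak_order_on_def by blast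
    show ?case
    proof (cases "Z = {}")
      case True
      then show ?thesis
        using R by (intro exI[of _ "[]"]) (auto simp: awalk_Nil_iff path_rel_def)
    next
      case False
      \<comment> \<open>The maximal elements. \<open>M\<close> is nonempty because asymmetry and
        negative transitivity make \<open>R\<close> a strict partial order on a finite nonempty
        set.\<close>
      define M where "M = {m \<in> Z. \<forall>w \<in> Z. (m, w) \<notin> R}"
      have "asymp_on Z (\<lambda>i j. (i, j) \<in> R)"
        using asym by (intro asymp_onI) blast
      moreover have "transp_on Z (\<lambda>i j. (i, j) \<in> R)"
        using asym negtrans by (intro transp_onI) metis
      ultimately obtain m where m: "m \<in> Z" "\<forall>w \<in> Z. w \<noteq> m \<longrightarrow> (m, w) \<notin> R"
        using Finite_Set.bex_max_element[OF psubset.hyps(1) _ _ False] by blast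
      moreover have "(m, m) \<notin> R"
        using asym[of m m] by blast
      ultimately have "m \<in> M"
        unfolding M_def mem_Collect_eq by metis
      define Y where "Y = Z - M"
      have Y: "Y \<subset> Z"
        using \<open>m \<in> Z\<close> \<open>m \<in> M\<close> by (auto simp: Y_def)
      have "weak_order_on Y (R \<inter> Y \<times> Y)"
        unfolding weak_order_on_def
      proof (intro conjI ballI impI)
        show "asym_on Y (R \<inter> Y \<times> Y)"
          using asym by (metis IntD1 asym_onI)
        fix i j k
        assume "i \<in> Y" "j \<in> Y" "k \<in> Y"
          and "(i, j) \<notin> R \<inter> Y \<times> Y \<and> (j, k) \<notin> R \<inter> Y \<times> Y"
        then show "(i, k) \<notin> R \<inter> Y \<times> Y"
          using Y negtrans[of i j k] by blast
      qed simp
      then obtain p where p: "awalk {} p Y" "path_rel p = R \<inter> Y \<times> Y"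
        using psubset.IH[of Y "R \<inter> Y \<times> Y"] Y psubset.prems(2) by auto
      have "awalk Y [(Y, Z)] Z"
        using Y psubset.prems(2) by (auto simp: awalk_simps)
      then have "awalk {} (p @ [(Y, Z)]) Z"
        using p(1) by (rule awalk_appendI[rotated])
      moreover have "path_rel (p @ [(Y, Z)]) = R"
      proof -
        have "path_rel (p @ [(Y, Z)]) = path_rel p \<union> Y \<times> M"
          using Y by (auto simp: path_rel_def Y_def M_def)
        moreover have "Y \<times> M \<subseteq> R"
        proof clarify
          fix i m
          assume "i \<in> Y" "m \<in> M"
          \<comment> \<open>\<open>i\<close> is not maximal, so some \<open>w\<close> lies above it,
            but not above the maximal \<open>m\<close>; negative transitivity then places
            \<open>i\<close> below \<open>m\<close>.\<close>
          then obtain w where "w \<in> Z" "(i, w) \<in> R" "(m, w) \<notin> R" "i \<in> Z" "m \<in> Z"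
            by (auto simp: Y_def M_def)
          then show "(i, m) \<in> R"
            using negtrans[of i m w] by blast
        qed
        moreover have "R \<subseteq> Y \<times> Z"
          using R by (auto simp: Y_def M_def)
        ultimately show ?thesis
          using p(2) by (auto simp: Y_def)
      qed
      ultimately show ?thesis
        by blast
    qed
  qed
  then show ?thesis
    using that by blast
qed

text \<open>The sum at \<open>(i, j)\<close> has at most one nonzero term, from the unique path arc
  at which \<open>j\<close> enters; it occurs exactly when \<open>i\<close> lies in the tail of that
  arc.\<close>

lemma wo_projection_indicator:
  assumes "awalk {} p S"
  shows "wo_projection S (indicator (set p)) = indicator (path_rel p)"
proof (rule ext, clarify)
  fix i j
  show "wo_projection S (indicator (set p)) (i, j) = indicator (path_rel p) (i, j)"
  proof (cases "(i, j) \<in> offdiag S")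
    case False
    then show ?thesis
      \<comment> \<open>Outside \<open>offdiag S\<close> the projection is 0 by definition, and the
        other side by irreflexivity of the weak order on \<open>S\<close>.\<close>
      using weak_order_on_indicator[OF weak_order_path_rel[OF assms]]
      by (simp add: wo_projection_def coord_space_def)
  next
    case True
    let ?B = "{(X, Z) \<in> arcs (wo_network S). i \<in> X \<and> j \<in> Z - X}"
    have "set p \<subseteq> arcs (wo_network S)"
      using assms by (simp add: awalk_def)
    have "finite ?B"
      by (rule finite_subset[OF _ finite_arcs]) auto
    obtain U V where UV: "(U, V) \<in> set p" "j \<in> V - U"
      using awalk_wo_entering_arc[OF assms, of j] True unfolding offdiag_def by blast
    have unique: "a = (U, V)" if "a \<in> set p" "j \<in> snd a - fst a" for a
      using awalk_wo_arcs_linear[OF assms UV(1), of "fst a" "snd a"] that UV by auto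
    have "wo_projection S (indicator (set p)) (i, j) = (\<Sum>a \<in> ?B. indicator (set p) a)"
      using True by (simp add: wo_projection_def case_prod_beta)
    also have "\<dots> = (\<Sum>a \<in> ?B. if a = (U, V) then 1 else 0)"
    proof (rule sum.cong[OF refl])
      fix a
      assume "a \<in> ?B"
      then have "j \<in> snd a - fst a"
        by (cases a) simp
      with UV(1) unique[of a] show "indicator (set p) a = (if a = (U, V) then 1 else 0 :: real)"
        by (cases "a \<in> set p") auto
    qed
    also have "\<dots> = of_bool ((U, V) \<in> ?B)"
      using \<open>finite ?B\<close> by (simp only: sum.delta of_bool_def)
    also have "(U, V) \<in> ?B \<longleftrightarrow> i \<in> U"
      using UV \<open>set p \<subseteq> arcs (wo_network S)\<close> by blast
    also have "i \<in> U \<longleftrightarrow> (i, j) \<in> path_rel p"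
    proof
      assume "(i, j) \<in> path_rel p"
      then obtain X Z where "(X, Z) \<in> set p" "i \<in> X" "j \<in> Z - X"
        by (auto simp: path_rel_def)
      with unique[of "(X, Z)"] show "i \<in> U"
        by simp
    qed (use UV in \<open>auto simp: path_rel_def\<close>)
    also have "of_bool ((i, j) \<in> path_rel p) = (indicator (path_rel p) (i, j) :: real)"
      by (simp add: indicator_def)
    finally show ?thesis .
  qed
qed

text \<open>A linear map commutes with the convex hull, so it suffices to match the generating
  points.\<close>

lemma wo_projection_flow_polytope:
  "wo_projection S ` flow_polytope (wo_network S) {} S = weak_order_polytope S"
proof -
  have "wo_projection S ` {indicator (set p) | p. apath {} p S} = {indicator R | R. weak_order_on S R}"
    (is "?L = ?R")
  proof
    show "?L \<subseteq> ?R"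
      using wo_projection_indicator weak_order_path_rel by (auto dest!: awalkI_apath)
    show "?R \<subseteq> ?L"
    proof clarify
      fix R
      assume "weak_order_on S R"
      then obtain p where p: "awalk {} p S" "path_rel p = R"
        by (rule weak_order_obtains_awalk) auto
      then have "indicator R = wo_projection S (indicator (set p))"
        by (simp add: wo_projection_indicator)
      then show "indicator R \<in> ?L"
        using awalk_imp_apath[OF p(1)] by blast
    qed
  qed
  then show ?thesis
    unfolding flow_polytope_def weak_order_polytope_def
    by (simp add: convex_hull_linear_image[OF linear_wo_projection])
qed

end

section \<open>The extended formulation and its size\<close>

lemma polytope_weak_order_polytope:
  assumes "finite S"
  shows "polytope (weak_order_polytope S)"
proof -
  have "{indicator R | R. weak_order_on S R} \<subseteq> (indicator ` Pow (S \<times> S) :: ('a \<times> 'a \<Rightarrow> real) set)"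
    by (auto simp: weak_order_on_def)
  then have "finite {indicator R :: 'a \<times> 'a \<Rightarrow> real | R. weak_order_on S R}"
    by (rule finite_subset) (use assms in simp)
  then show ?thesis
    unfolding weak_order_polytope_def polytope_def by blast
qed

theorem theorem2:
  fixes S :: "'a set" and n :: nat
  assumes "finite S" and "card S = n" and "n \<ge> 1"
  shows "wo_projection S ` flow_polytope (wo_network S) {} S = weak_order_polytope S
    \<and> solution_set (flow_description (wo_network S) {} S) = flow_polytope (wo_network S) {} S
    \<and> extended_formulation (flow_description (wo_network S) {} S) (weak_order_polytope S)
    \<and> lin_system_size (flow_description (wo_network S) {} S) = 3 ^ n - 2 ^ n"
proof -
  interpret acyclic_fin_digraph "wo_network S"
    using assms(1) by (rule acyclic_fin_digraph_wo_network)
  let ?L = "flow_description (wo_network S) {} S"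
  \<comment> \<open>Source and sink differ, as path decomposition requires.\<close>
  have "S \<noteq> {}"
    using assms by auto
  then have sol: "solution_set ?L = flow_polytope (wo_network S) {} S"
    by (intro solution_set_flow_description_eq) auto
  note proj = wo_projection_flow_polytope[OF assms(1)]
  have "(\<lambda>\<Phi>. wo_projection S \<Phi> + 0) ` solution_set ?L = weak_order_polytope S"
    using sol proj by simp
  then have "extended_formulation ?L (weak_order_polytope S)"
    using wf_flow_description polytope_flow_polytope sol polytope_weak_order_polytope[OF assms(1)]
      linear_wo_projection
    unfolding extended_formulation_def by metis
  then show ?thesis
    using proj sol card_arcs_wo_network[OF assms(1)] assms(2)
    by (simp add: lin_system_size_flow_description)
qed

end
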